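(* Let $\mathcal{K}_k$ denote the family of all non-monochromatic bicolored complete graphs on $k$ vertices. Then $\mathrm{ex}(\tfrac12,\mathcal{K}_k)=1-\frac{1}{k+O(1)}$ for $k\ge 3$; that is, there is an absolute constant $C$ such that for every $k\geq 3$ one has $\mathrm{ex}(\tfrac12,\mathcal{K}_k)=1-\frac{1}{k+c_k}$ for some real $c_k$ with $|c_k|\leq C$.
   Context: A bicolored graph is a simple graph whose edges are each colored red or blue; it is non-monochromatic if both colors occur. A bicolored graph $G$ is $\varepsilon$-balanced if each color class contains at least $\varepsilon\cdot e(G)$ edges. $G$ contains $F$ if there is an injective map $V(F)\to V(G)$ sending every edge of $F$ to an edge of $G$ of the same color. For a family $\mathcal{F}$ of bicolored graphs, $\mathrm{ex}(\varepsilon,n,\mathcal{F})$ is the maximum number of edges of an $n$-vertex $\varepsilon$-balanced bicolored graph containing no member of $\mathcal{F}$, and $\mathrm{ex}(\varepsilon,\mathcal{F}):=\lim_{n\to\infty}\mathrm{ex}(\varepsilon,n,\mathcal{F})/\binom{n}{2}$. *)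

theory Defs
  imports Complex_Main
begin

record 'a bicolored_graph =
  verts :: "'a set"
  red :: "'a set set"
  blue :: "'a set set"

definition all_pairs :: "'a set \<Rightarrow> 'a set set" where
  "all_pairs V = {e. e \<subseteq> V \<and> card e = 2}"

definition edges :: "'a bicolored_graph \<Rightarrow> 'a set set" where
  "edges G = red G \<union> blue G"

definition is_bicolored_graph :: "'a bicolored_graph \<Rightarrow> bool" where
  "is_bicolored_graph G \<longleftrightarrow>
     finite (verts G) \<and> edges G \<subseteq> all_pairs (verts G) \<and> red G \<inter> blue G = {}"

definition non_monochromatic :: "'a bicolored_graph \<Rightarrow> bool" where
  "non_monochromatic G \<longleftrightarrow> red G \<noteq> {} \<and> blue G \<noteq> {}"

definition balanced :: "real \<Rightarrow> 'a bicolored_graph \<Rightarrow> bool" where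
  "balanced \<epsilon> G \<longleftrightarrow>
     real (card (red G)) \<ge> \<epsilon> * real (card (edges G)) \<and>
     real (card (blue G)) \<ge> \<epsilon> * real (card (edges G))"

definition contains :: "'a bicolored_graph \<Rightarrow> 'b bicolored_graph \<Rightarrow> bool" where
  "contains G F \<longleftrightarrow>
     (\<exists>f. inj_on f (verts F) \<and> f ` verts F \<subseteq> verts G \<and>
          (\<forall>e\<in>red F. f ` e \<in> red G) \<and> (\<forall>e\<in>blue F. f ` e \<in> blue G))"

text \<open>Vertices are taken to be natural numbers; every finite graph is isomorphic to one of
  this form. The edge counts below are at most \<open>n choose 2\<close>, so \<open>Max\<close> is taken over a finite
  set; that set contains \<open>0\<close> (from the edgeless graph) whenever every member of \<open>\<F>\<close> has
  an edge.\<close>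

definition ex_number :: "real \<Rightarrow> nat \<Rightarrow> nat bicolored_graph set \<Rightarrow> nat" where
  "ex_number \<epsilon> n \<F> =
     Max {card (edges G) | G :: nat bicolored_graph.
            is_bicolored_graph G \<and> card (verts G) = n \<and> balanced \<epsilon> G \<and>
            (\<forall>F\<in>\<F>. \<not> contains G F)}"

definition ex_ratio :: "real \<Rightarrow> nat bicolored_graph set \<Rightarrow> nat \<Rightarrow> real" where
  "ex_ratio \<epsilon> \<F> n = real (ex_number \<epsilon> n \<F>) / real (n choose 2)"

text \<open>The value is meaningful only if \<open>ex_ratio \<epsilon> \<F>\<close> is convergent.\<close>

definition ex_density :: "real \<Rightarrow> nat bicolored_graph set \<Rightarrow> real" where
  "ex_density \<epsilon> \<F> = lim (ex_ratio \<epsilon> \<F>)"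

definition nonmono_cliques :: "nat \<Rightarrow> nat bicolored_graph set" where
  "nonmono_cliques k =
     {F. is_bicolored_graph F \<and> card (verts F) = k \<and>
         edges F = all_pairs (verts F) \<and> non_monochromatic F}"

end

theory Submission
  imports Defs
begin

text \<open>Blow-ups preserve balance and create no new cliques, so the ratios converge to
  \<open>sup 2 ex(1/2, n) / n\<^sup>2\<close>; the Turan graph with \<open>k - 1\<close> parts of size 2, half of its edges red,
  gives \<open>1 - 1 / (k - 1)\<close> as a lower bound for the limit.

  For the upper bound let \<open>m v\<close> be the number of non-neighbours of \<open>v\<close>, itself included, and let
  \<open>Q\<close> be a clique with at least \<open>k\<close> vertices, hence monochromatic, say red. The ends of a blue
  edge have few common neighbours in \<open>Q\<close>, so together they miss at least \<open>|Q| - k + 2\<close> vertices of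
  \<open>Q\<close>. Summing over the blue edges, of which there are at least \<open>n\<^sup>2 / 8\<close>, gives
  \<open>|Q| - k + 2 \<le> 8 m(Q) / n\<close>, where \<open>m(Q)\<close> is the sum of \<open>m\<close> over \<open>Q\<close>. On the other hand, the
  Caro-Wei bound with vertex weights \<open>1 - 8 m v / n\<close> yields a clique with
  \<open>|Q| - 8 m(Q) / n \<ge> (\<Sum>v. 1 / m v) - 8\<close>. Hence \<open>\<Sum>v. 1 / m v \<le> k + 7\<close>, which bounds the number of
  edges by convexity.\<close>

section \<open>Vertex pairs and degree sums\<close>

lemma finite_all_pairs: "finite V \<Longrightarrow> finite (all_pairs V)"
  by (simp add: all_pairs_def)

lemma all_pairs_mono: "S \<subseteq> V \<Longrightarrow> all_pairs S \<subseteq> all_pairs V"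
  by (auto simp: all_pairs_def)

lemma pair_in_all_pairs: "{u, v} \<in> all_pairs V \<longleftrightarrow> u \<in> V \<and> v \<in> V \<and> u \<noteq> v"
  by (auto simp: all_pairs_def card_2_iff doubleton_eq_iff)

lemma edge_ends:
  assumes "{u, v} \<in> X" "X \<subseteq> all_pairs V"
  shows "u \<in> V" "v \<in> V" "u \<noteq> v"
  using subsetD[OF assms(2,1)] by (auto simp: pair_in_all_pairs)

lemma all_pairsE:
  assumes "e \<in> all_pairs V"
  obtains u v where "e = {u, v}" "u \<in> V" "v \<in> V" "u \<noteq> v"
  using assms by (auto simp: all_pairs_def card_2_iff)

text \<open>Double count of the ordered pairs \<open>(v, u)\<close> with \<open>{v, u}\<close> in
  \<open>X\<close>: by first entry, and by edge, each edge arising from exactly two of them.\<close>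

lemma handshake:
  assumes V: "finite V" and X: "X \<subseteq> all_pairs V"
  shows "(\<Sum>v\<in>V. card {u\<in>V. {v, u} \<in> X}) = 2 * card X"
proof -
  have fX: "finite X"
    using X V finite_all_pairs finite_subset by blast
  have XV: "v \<in> V" "u \<in> V" if "{v, u} \<in> X" for v u
    using edge_ends[OF that X] by auto
  have "(\<Sum>v\<in>V. card {u\<in>V. {v, u} \<in> X}) = card (SIGMA v:V. {u\<in>V. {v, u} \<in> X})"
    using V by simp
  also have "(SIGMA v:V. {u\<in>V. {v, u} \<in> X}) = (\<Union>e\<in>X. {(v, u). {v, u} = e})"
    by (auto dest: XV)
  also have "card \<dots> = (\<Sum>e\<in>X. card {(v, u). {v, u} = e})"
  proof (rule card_UN_disjoint)
    show "\<forall>e\<in>X. finite {(v, u). {v, u} = e}"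
    proof
      fix e assume "e \<in> X"
      then have "{(v, u). {v, u} = e} \<subseteq> V \<times> V"
        by (auto dest: XV)
      then show "finite {(v, u). {v, u} = e}"
        using V finite_subset by blast
    qed
    show "\<forall>i\<in>X. \<forall>j\<in>X. i \<noteq> j \<longrightarrow> {(v, u). {v, u} = i} \<inter> {(v, u). {v, u} = j} = {}"
      by blast
  qed (rule fX)
  also have "\<dots> = (\<Sum>e\<in>X. 2)"
  proof (rule sum.cong)
    fix e assume "e \<in> X"
    then obtain a b where ab: "e = {a, b}" "a \<noteq> b"
      using X by (meson all_pairsE subsetD)
    then have "{(v, u). {v, u} = e} = {(a, b), (b, a)}"
      by (auto simp: doubleton_eq_iff)
    then show "card {(v, u). {v, u} = e} = 2"
      using ab by simp
  qed simp
  finally show ?thesis by simp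
qed

text \<open>Sum \<open>g v + g u\<close> over ordered pairs: those from \<open>X\<close> pay at
  least \<open>t\<close> each, and since \<open>g\<close> is nonnegative the sum may be extended to
  all of \<open>V \<times> V\<close>. It is used with \<open>X\<close> a color class and
  \<open>g\<close> the number of clique vertices missed.\<close>

lemma weighted_edge_bound:
  fixes g :: "'a \<Rightarrow> real" and t :: real
  assumes V: "finite V" and X: "X \<subseteq> all_pairs V" and g: "\<And>v. v \<in> V \<Longrightarrow> g v \<ge> 0"
    and t: "\<And>u v. {u, v} \<in> X \<Longrightarrow> t \<le> g u + g v"
  shows "t * card X \<le> card V * (\<Sum>v\<in>V. g v)"
proof -
  have "2 * (t * card X) = t * real (\<Sum>v\<in>V. card {u\<in>V. {v, u} \<in> X})"
    by (simp add: handshake[OF V X])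
  also have "\<dots> = (\<Sum>v\<in>V. \<Sum>u\<in>{u\<in>V. {v, u} \<in> X}. t)"
    by (simp add: sum_distrib_left mult.commute)
  also have "\<dots> \<le> (\<Sum>v\<in>V. \<Sum>u\<in>{u\<in>V. {v, u} \<in> X}. g v + g u)"
    using t by (intro sum_mono) auto
  also have "\<dots> \<le> (\<Sum>v\<in>V. \<Sum>u\<in>V. g v + g u)"
    using V g by (intro sum_mono sum_mono2) auto
  also have "\<dots> = 2 * (card V * (\<Sum>v\<in>V. g v))"
    by (simp add: sum.distrib sum_distrib_left)
  finally show ?thesis by simp
qed

section \<open>A weighted Caro-Wei bound\<close>

text \<open>Greedy choice: always take a vertex maximising the ratio of weight to the number of
  non-neighbours, itself included.\<close>

lemma weighted_Caro_Wei_nonneg: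
  fixes w :: "'a \<Rightarrow> real"
  assumes "finite H" and irr: "\<And>u. \<not> adj u u" and sym: "\<And>u v. adj u v \<Longrightarrow> adj v u"
    and "\<And>v. v \<in> H \<Longrightarrow> w v \<ge> 0"
  shows "\<exists>Q\<subseteq>H. (\<forall>u\<in>Q. \<forall>v\<in>Q. u \<noteq> v \<longrightarrow> adj u v) \<and>
           (\<Sum>v\<in>H. w v / card {u\<in>H. \<not> adj v u}) \<le> (\<Sum>v\<in>Q. w v)"
  using assms(1,4)
proof (induction H rule: finite_psubset_induct)
  case (psubset H)
  define m where "m S v = real (card {u\<in>S. \<not> adj v u})" for S v
  have m_pos: "m S v > 0" if "v \<in> S" "S \<subseteq> H" for S v
  proof -
    have "finite S"
      using that psubset.hyps by (blast intro: finite_subset)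
    moreover have "v \<in> {u\<in>S. \<not> adj v u}"
      using that irr by simp
    ultimately have "card {u\<in>S. \<not> adj v u} > 0"
      unfolding card_gt_0_iff by (metis (no_types, lifting) empty_iff finite_Collect_conjI finite_subset mem_Collect_eq subsetI)
    then show ?thesis by (simp add: m_def)
  qed
  show ?case
  proof (cases "H = {}")
    case False
    let ?I = "(\<lambda>v. w v / m H v) ` H"
    have I: "finite ?I" "?I \<noteq> {}"
      using False psubset.hyps by auto
    from Max_in[OF this] obtain u where "u \<in> H" "Max ?I = w u / m H u"
      by auto
    with Max_ge[OF I(1)] have u: "u \<in> H" "\<And>v. v \<in> H \<Longrightarrow> w v / m H v \<le> w u / m H u"
      by auto
    define H' where "H' = {v\<in>H. adj u v}"
    have H': "H' \<subset> H"
      using u(1) irr by (auto simp: H'_def)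
    obtain Q where Q: "Q \<subseteq> H'" "\<forall>u\<in>Q. \<forall>v\<in>Q. u \<noteq> v \<longrightarrow> adj u v"
      "(\<Sum>v\<in>H'. w v / m H' v) \<le> (\<Sum>v\<in>Q. w v)"
      using psubset.IH[OF H'] psubset.prems H' unfolding m_def by (meson psubsetD)
    \<comment> \<open>Exactly \<open>m H u\<close> vertices are discarded with \<open>u\<close>,
      each with ratio at most that of \<open>u\<close>, so \<open>w u\<close> pays for all of
      them.\<close>
    have "(\<Sum>v\<in>H. w v / m H v) = (\<Sum>v\<in>H - H'. w v / m H v) + (\<Sum>v\<in>H'. w v / m H v)"
      using H' psubset.hyps by (intro sum.subset_diff) auto
    also have "(\<Sum>v\<in>H - H'. w v / m H v) \<le> (\<Sum>v\<in>H - H'. w u / m H u)"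
      using u by (intro sum_mono) auto
    also have "\<dots> = m H u * (w u / m H u)"
      by (simp add: m_def H'_def set_diff_eq conj_commute cong: conj_cong)
    also have "\<dots> = w u"
      using m_pos[OF u(1)] by simp
    \<comment> \<open>Passing to \<open>H'\<close> can only lower the numbers of non-neighbours, so
      these terms grow; this relies on nonnegative weights.\<close>
    also have "(\<Sum>v\<in>H'. w v / m H v) \<le> (\<Sum>v\<in>H'. w v / m H' v)"
    proof (rule sum_mono)
      fix v assume v: "v \<in> H'"
      have "m H' v \<le> m H v"
        unfolding m_def using H' psubset.hyps
        by (auto intro!: card_mono)
      then show "w v / m H v \<le> w v / m H' v"
        using v H' m_pos[OF v] psubset.prems[of v] by (intro divide_left_mono) auto
    qed
    also note Q(3)
    also have "w u + (\<Sum>v\<in>Q. w v) = (\<Sum>v\<in>insert u Q. w v)"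
    proof (subst sum.insert)
      show "finite Q" "u \<notin> Q"
        using Q(1) psubset.hyps irr finite_subset[of Q H] by (auto simp: H'_def)
    qed simp
    finally have "(\<Sum>v\<in>H. w v / m H v) \<le> (\<Sum>v\<in>insert u Q. w v)" by simp
    moreover have "\<forall>a\<in>insert u Q. \<forall>b\<in>insert u Q. a \<noteq> b \<longrightarrow> adj a b"
      using Q(1,2) sym by (auto simp: H'_def)
    moreover have "insert u Q \<subseteq> H"
      using Q(1) u(1) H' by auto
    ultimately show ?thesis
      unfolding m_def by blast
  qed auto
qed

text \<open>Vertices of negative weight contribute negative terms and may be dropped; for the
  others, fewer non-neighbours remain. The weights \<open>1 - 8 m v / n\<close> of the application
  can be negative.\<close>

lemma weighted_Caro_Wei:
  fixes w :: "'a \<Rightarrow> real"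
  assumes H: "finite H" and irr: "\<And>u. \<not> adj u u" and sym: "\<And>u v. adj u v \<Longrightarrow> adj v u"
  shows "\<exists>Q\<subseteq>H. (\<forall>u\<in>Q. \<forall>v\<in>Q. u \<noteq> v \<longrightarrow> adj u v) \<and>
           (\<Sum>v\<in>H. w v / card {u\<in>H. \<not> adj v u}) \<le> (\<Sum>v\<in>Q. w v)"
proof -
  define U where "U = {v\<in>H. w v \<ge> 0}"
  have U: "finite U" "U \<subseteq> H"
    using H by (auto simp: U_def)
  obtain Q where Q: "Q \<subseteq> U" "\<forall>u\<in>Q. \<forall>v\<in>Q. u \<noteq> v \<longrightarrow> adj u v"
    "(\<Sum>v\<in>U. w v / card {u\<in>U. \<not> adj v u}) \<le> (\<Sum>v\<in>Q. w v)"
    using weighted_Caro_Wei_nonneg[OF U(1), where adj = adj and w = w, OF irr sym] by (auto simp: U_def)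
  have "(\<Sum>v\<in>H. w v / card {u\<in>H. \<not> adj v u}) \<le> (\<Sum>v\<in>U. w v / card {u\<in>H. \<not> adj v u})"
    unfolding U_def using H
    by (subst sum.inter_filter) (auto intro!: sum_mono simp: divide_nonpos_nonneg)
  also have "\<dots> \<le> (\<Sum>v\<in>U. w v / card {u\<in>U. \<not> adj v u})"
  proof (rule sum_mono)
    fix v assume v: "v \<in> U"
    have "card {u\<in>U. \<not> adj v u} \<le> card {u\<in>H. \<not> adj v u}"
      using U H by (auto intro!: card_mono)
    moreover have "card {u\<in>U. \<not> adj v u} > 0"
      using v irr U by (auto simp: card_gt_0_iff)
    ultimately show "w v / card {u\<in>H. \<not> adj v u} \<le> w v / card {u\<in>U. \<not> adj v u}"
      using v by (intro divide_left_mono) (auto simp: U_def)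
  qed
  finally show ?thesis
    using Q U by (meson order_trans)
qed

section \<open>Upper bound on the edge density\<close>

text \<open>Some vertex of \<open>Q\<close> meets both colors, so three vertices already witness
  both; since \<open>3 \<le> k\<close>, they extend to \<open>k\<close> vertices inside
  \<open>Q\<close>.\<close>

lemma nonmono_clique_contained:
  fixes G :: "nat bicolored_graph"
  assumes G: "is_bicolored_graph G" and Q: "Q \<subseteq> verts G" "all_pairs Q \<subseteq> edges G"
    and k: "3 \<le> k" "k \<le> card Q"
    and r: "red G \<inter> all_pairs Q \<noteq> {}" and b: "blue G \<inter> all_pairs Q \<noteq> {}"
  shows "\<exists>F\<in>nonmono_cliques k. contains G F"
proof -
  have fQ: "finite Q"
    using G Q finite_subset[of Q "verts G"] by (simp_all add: is_bicolored_graph_def)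
  have "\<exists>x y z. x \<in> Q \<and> y \<in> Q \<and> z \<in> Q \<and> {x, y} \<in> red G \<and> {x, z} \<in> blue G"
  proof -
    obtain a a' where a: "{a, a'} \<in> red G" "a \<in> Q" "a' \<in> Q" "a \<noteq> a'"
      using r by (auto elim!: all_pairsE)
    obtain b b' where b: "{b, b'} \<in> blue G" "b \<in> Q" "b' \<in> Q" "b \<noteq> b'"
      using b by (auto elim!: all_pairsE)
    show ?thesis
    proof (cases "a = b")
      case False
      \<comment> \<open>If this edge is red, then \<open>b\<close> meets both colors; if it is blue,
        then \<open>a\<close> does.\<close>
      then have "{a, b} \<in> edges G"
        using Q a b by (auto simp: pair_in_all_pairs)
      then consider "{b, a} \<in> red G" | "{a, b} \<in> blue G"
        by (auto simp: edges_def insert_commute)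
      then show ?thesis
        using a b by cases blast+
    qed (use a b in blast)
  qed
  then obtain x y z where xyz: "x \<in> Q" "y \<in> Q" "z \<in> Q" "{x, y} \<in> red G" "{x, z} \<in> blue G"
    by blast
  have "card {x, y, z} \<le> k"
    using k(1) by (simp add: card_insert_if)
  then obtain S where S: "{x, y, z} \<subseteq> S" "S \<subseteq> Q" "card S = k"
    using exists_subset_between[of "{x, y, z}" k Q] k fQ xyz by auto
  define F where "F = \<lparr>verts = S, red = red G \<inter> all_pairs S, blue = blue G \<inter> all_pairs S\<rparr>"
  have pairs: "all_pairs S \<subseteq> edges G"
    using S(2) Q(2) by (meson all_pairs_mono order_trans)
  have xy: "x \<noteq> y" "x \<noteq> z"
    using G xyz by (auto simp: is_bicolored_graph_def edges_def all_pairs_def)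
  have "{x, y} \<in> red G \<inter> all_pairs S" "{x, z} \<in> blue G \<inter> all_pairs S"
    using S xyz xy by (auto simp: pair_in_all_pairs)
  then have "red G \<inter> all_pairs S \<noteq> {}" "blue G \<inter> all_pairs S \<noteq> {}"
    by blast+
  moreover have "finite S" "red G \<inter> blue G = {}"
    using S(2) fQ G finite_subset[of S Q] by (auto simp: is_bicolored_graph_def)
  moreover have "edges F = all_pairs S"
    using pairs by (auto simp: F_def edges_def)
  ultimately have "F \<in> nonmono_cliques k"
    unfolding nonmono_cliques_def is_bicolored_graph_def non_monochromatic_def
    using S(3) by (auto simp: F_def)
  moreover have "contains G F"
    unfolding contains_def using S Q
    by (intro exI[of _ id]) (auto simp: F_def)
  ultimately show ?thesis by blast
qed

text \<open>Fewer than \<open>k\<close> vertices make the bound trivial. Otherwise \<open>Q\<close>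
  lacks one color, and averaging over the edges of that color bounds the size of \<open>Q\<close>.
  Both colors are assumed dense because either may be the absent one.\<close>

lemma card_clique_le:
  fixes G :: "nat bicolored_graph"
  assumes G: "is_bicolored_graph G" and free: "\<forall>F\<in>nonmono_cliques k. \<not> contains G F"
    and k: "3 \<le> k" and Q: "Q \<subseteq> verts G" "all_pairs Q \<subseteq> edges G"
    and n: "n = card (verts G)" "0 < n"
    and r: "n\<^sup>2 \<le> 8 * card (red G)" and b: "n\<^sup>2 \<le> 8 * card (blue G)"
  shows "real (card Q) - 8 * (\<Sum>v\<in>Q. card {u\<in>verts G. {v, u} \<notin> edges G}) / n \<le> k - 1"
proof (cases "card Q < k")
  case True
  have "0 \<le> 8 * (\<Sum>v\<in>Q. card {u\<in>verts G. {v, u} \<notin> edges G}) / n"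
    by (simp add: sum_nonneg)
  then show ?thesis using True k by linarith
next
  case False
  have fV: "finite (verts G)" and fQ: "finite Q"
    using G Q finite_subset[of Q "verts G"] by (simp_all add: is_bicolored_graph_def)
  define mis where "mis v = card {w\<in>Q. {v, w} \<notin> edges G}" for v
  \<comment> \<open>Non-adjacent pairs in \<open>verts G \<times> Q\<close>, counted from either
    side.\<close>
  have sum_mis: "(\<Sum>v\<in>verts G. mis v) = (\<Sum>v\<in>Q. card {u\<in>verts G. {v, u} \<notin> edges G})"
  proof -
    have "(\<Sum>v\<in>verts G. mis v) = (\<Sum>v\<in>verts G. \<Sum>w\<in>{w\<in>Q. {v, w} \<notin> edges G}. 1)"
      by (simp add: mis_def)
    also have "\<dots> = (\<Sum>w\<in>Q. \<Sum>v\<in>{v\<in>verts G. {v, w} \<notin> edges G}. 1)"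
      by (rule sum.swap_restrict[OF fV fQ])
    finally show ?thesis by (simp add: insert_commute)
  qed
  have mono: "red G \<inter> all_pairs S = {} \<or> blue G \<inter> all_pairs S = {}"
    if "S \<subseteq> verts G" "all_pairs S \<subseteq> edges G" "k \<le> card S" for S
    using nonmono_clique_contained[OF G that(1,2) k that(3)] free by blast
  text \<open>Otherwise the common neighbours of \<open>u\<close> and \<open>v\<close> in \<open>Q\<close>, together with \<open>u\<close> and \<open>v\<close>, would
    form a non-monochromatic clique.\<close>
  have miss: "card Q + 2 \<le> k + (mis u + mis v)"
    if uv: "{u, v} \<in> edges G" "{u, v} \<in> X" and XY: "(X = red G \<and> Y = blue G) \<or> (X = blue G \<and> Y = red G)"
      and X: "X \<inter> all_pairs Q = {}" for u v X Y
  proof (rule ccontr)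
    assume less: "\<not> ?thesis"
    define W where "W = {w\<in>Q. {u, w} \<in> edges G \<and> {v, w} \<in> edges G}"
    have sub: "edges G \<subseteq> all_pairs (verts G)"
      using G by (simp add: is_bicolored_graph_def)
    have uv': "u \<in> verts G" "v \<in> verts G" "u \<noteq> v"
      using edge_ends[OF uv(1) sub] .
    have "Q = W \<union> ({w\<in>Q. {u, w} \<notin> edges G} \<union> {w\<in>Q. {v, w} \<notin> edges G})"
      by (auto simp: W_def)
    then have "card Q \<le> card W + (mis u + mis v)"
      unfolding mis_def by (metis (no_types, lifting) card_Un_le nat_add_left_cancel_le order_trans)
    then have cW: "k - 1 \<le> card W"
      using less by linarith
    have fW: "finite W" and WQ: "W \<subseteq> Q"
      using fQ by (auto simp: W_def)
    have notin: "u \<notin> W" "v \<notin> W"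
      using edge_ends(3)[OF _ sub, of u u] edge_ends(3)[OF _ sub, of v v] by (auto simp: W_def)
    define S where "S = insert u (insert v W)"
    have SE: "all_pairs S \<subseteq> edges G"
    proof
      fix e assume "e \<in> all_pairs S"
      then obtain a b where ab: "e = {a, b}" "a \<in> S" "b \<in> S" "a \<noteq> b"
        by (rule all_pairsE)
      have "{a, b} \<in> edges G" if "a \<in> W" "b \<in> W"
        using that ab(4) Q(2) WQ pair_in_all_pairs[of a b Q] by blast
      moreover have "{u, w} \<in> edges G" "{v, w} \<in> edges G" "{w, u} \<in> edges G" "{w, v} \<in> edges G"
        if "w \<in> W" for w
        using that by (auto simp: W_def insert_commute)
      moreover have "{v, u} \<in> edges G" using uv(1) by (simp add: insert_commute)
      ultimately show "e \<in> edges G"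
        using ab uv(1) by (auto simp: S_def)
    qed
    have "card S = card W + 2"
      using fW notin uv' by (simp add: S_def)
    then have "k \<le> card S" using cW k by linarith
    moreover have "S \<subseteq> verts G"
      using uv' WQ Q by (auto simp: S_def)
    ultimately have "X \<inter> all_pairs S = {} \<or> Y \<inter> all_pairs S = {}"
      using mono[of S] SE XY by blast
    moreover have "{u, v} \<in> X \<inter> all_pairs S"
      using uv uv' by (simp add: pair_in_all_pairs S_def)
    \<comment> \<open>\<open>W\<close> has at least \<open>k - 1 \<ge> 2\<close> vertices, and any
      pair in it lies in \<open>Q\<close>, where only the color \<open>Y\<close> occurs.\<close>
    moreover have "Y \<inter> all_pairs S \<noteq> {}"
    proof -
      have "2 \<le> card W" using cW k by linarith
      then obtain T where "T \<subseteq> W" "card T = 2"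
        using obtain_subset_with_card_n by metis
      then have T: "T \<in> all_pairs Q" "T \<in> all_pairs S"
        using WQ by (auto simp: all_pairs_def S_def)
      then have "T \<in> Y"
        using X XY Q(2) by (auto simp: edges_def)
      then show ?thesis using T by blast
    qed
    ultimately show False by blast
  qed
  obtain X Y where XY: "(X = red G \<and> Y = blue G) \<or> (X = blue G \<and> Y = red G)"
      and X: "X \<inter> all_pairs Q = {}"
  proof -
    have "red G \<inter> all_pairs Q = {} \<or> blue G \<inter> all_pairs Q = {}"
      using mono[of Q] Q False by simp
    then show ?thesis
      using that[of "red G" "blue G"] that[of "blue G" "red G"] by blast
  qed
  define t where "t = real (card Q) + 2 - k"
  have XE: "X \<subseteq> edges G" using XY by (auto simp: edges_def)
  have "t * card X \<le> n * (\<Sum>v\<in>verts G. real (mis v))"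
    unfolding n
  proof (rule weighted_edge_bound[OF fV])
    show "X \<subseteq> all_pairs (verts G)"
      using XE G by (auto simp: is_bicolored_graph_def)
    fix u v assume "{u, v} \<in> X"
    then show "t \<le> real (mis u) + real (mis v)"
      using miss[OF _ _ XY X, of u v] XE unfolding t_def by (simp add: subset_iff flip: of_nat_add)
  qed simp
  moreover have "t * (real n)\<^sup>2 \<le> t * (8 * card X)"
  proof (rule mult_left_mono)
    have "n\<^sup>2 \<le> 8 * card X"
      using r b XY by auto
    then show "(real n)\<^sup>2 \<le> 8 * card X"
      by (metis of_nat_le_iff of_nat_power)
    show "0 \<le> t" using False by (simp add: t_def)
  qed
  \<comment> \<open>Chains \<open>t n^2 \<le> 8 t |X| \<le> 8 n (\<Sum>v. mis v)\<close>, where the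
    first inequality uses \<open>t \<ge> 0\<close>.\<close>
  ultimately have "n * (t * n) \<le> n * (8 * (\<Sum>v\<in>verts G. real (mis v)))"
    by (simp add: power2_eq_square algebra_simps)
  then have "t * n \<le> 8 * (\<Sum>v\<in>verts G. real (mis v))"
    using n(2) by simp
  then have "t \<le> 8 * (\<Sum>v\<in>verts G. real (mis v)) / n"
    using n(2) by (simp add: field_simps)
  also have "(\<Sum>v\<in>verts G. real (mis v)) = (\<Sum>v\<in>Q. card {u\<in>verts G. {v, u} \<notin> edges G})"
    using sum_mis by (metis of_nat_sum)
  finally show ?thesis by (simp add: t_def)
qed

text \<open>The inequality between harmonic and arithmetic means. The parameter \<open>s\<close>
  allows any upper bound on the average \<open>n / s\<close> of \<open>m\<close> in place of its
  exact value.\<close>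

lemma sum_inverse_ge:
  fixes m :: "'a \<Rightarrow> real"
  assumes V: "finite V" "V \<noteq> {}" and m: "\<And>v. v \<in> V \<Longrightarrow> m v > 0" and s: "s > 0"
    and bound: "(\<Sum>v\<in>V. m v) \<le> (card V)\<^sup>2 / s"
  shows "s \<le> (\<Sum>v\<in>V. 1 / m v)"
proof -
  define n where "n = real (card V)"
  have n: "n > 0" using V by (simp add: n_def card_gt_0_iff)
  text \<open>The tangent line of \<open>1 / m\<close> at \<open>n / s\<close>.\<close>
  have "2 * s / n - (s / n)\<^sup>2 * m v \<le> 1 / m v" if "v \<in> V" for v
  proof -
    have "0 \<le> (1 - (s / n) * m v)\<^sup>2 / m v"
      using m[OF that] by (intro divide_nonneg_pos) auto
    also have "(1 - (s / n) * m v)\<^sup>2 / m v = 1 / m v - 2 * (s / n) + (s / n)\<^sup>2 * m v"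
      using m[OF that] n by (simp add: power2_eq_square field_simps)
    finally show ?thesis by simp
  qed
  then have "(\<Sum>v\<in>V. 2 * s / n - (s / n)\<^sup>2 * m v) \<le> (\<Sum>v\<in>V. 1 / m v)"
    by (intro sum_mono) auto
  moreover have "(\<Sum>v\<in>V. 2 * s / n - (s / n)\<^sup>2 * m v) = n * (2 * s / n) - (s / n)\<^sup>2 * (\<Sum>v\<in>V. m v)"
    by (simp add: sum_subtractf sum_distrib_left n_def)
  moreover have "(s / n)\<^sup>2 * (\<Sum>v\<in>V. m v) \<le> (s / n)\<^sup>2 * (n\<^sup>2 / s)"
    using bound by (intro mult_left_mono) (auto simp: n_def)
  moreover have "(s / n)\<^sup>2 * (n\<^sup>2 / s) = s" "n * (2 * s / n) = 2 * s"
    using n s by (auto simp: power2_eq_square field_simps)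
  ultimately show ?thesis by linarith
qed

text \<open>Below density \<open>1 / 2\<close> the claim is immediate. Above it, balance gives each
  color at least \<open>n^2 / 8\<close> edges, so \<open>card_clique_le\<close> applies to the
  clique found by the Caro-Wei bound.\<close>

lemma edge_density_le:
  fixes G :: "nat bicolored_graph"
  assumes G: "is_bicolored_graph G" and free: "\<forall>F\<in>nonmono_cliques k. \<not> contains G F"
    and bal: "balanced (1 / 2) G" and k: "3 \<le> k"
    and n: "n = card (verts G)" "0 < n"
  shows "2 * card (edges G) / (real n)\<^sup>2 \<le> 1 - 1 / (real k + 7)"
proof (cases "n\<^sup>2 \<le> 4 * card (edges G)")
  case False
  then have "real (4 * card (edges G)) < real (n\<^sup>2)"
    by (simp only: of_nat_less_iff)
  then have "2 * card (edges G) / (real n)\<^sup>2 \<le> 1 / 2"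
    using n(2) by (simp add: field_simps)
  also have "1 / 2 \<le> 1 - 1 / (real k + 7)"
    by (simp add: field_simps)
  finally show ?thesis .
next
  case True
  let ?V = "verts G" and ?E = "edges G"
  have V: "finite ?V" and E: "?E \<subseteq> all_pairs ?V"
    using G by (auto simp: is_bicolored_graph_def)
  have rb: "n\<^sup>2 \<le> 8 * card (red G)" "n\<^sup>2 \<le> 8 * card (blue G)"
    using True bal by (auto simp: balanced_def)
  define m where "m v = real (card {u\<in>?V. {v, u} \<notin> ?E})" for v
  have irr: "\<not> {u, u} \<in> ?E" for u
    using edge_ends(3)[OF _ E] by blast
  have m_pos: "m v > 0" if "v \<in> ?V" for v
    using that V irr[of v] unfolding m_def by (auto simp: card_gt_0_iff)
  have m_eq: "m v = n - real (card {u\<in>?V. {v, u} \<in> ?E})" for v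
  proof -
    have "{u\<in>?V. {v, u} \<notin> ?E} = ?V - {u\<in>?V. {v, u} \<in> ?E}" by auto
    then show ?thesis
      using V by (simp add: m_def n card_Diff_subset card_mono of_nat_diff)
  qed
  have sum_m: "(\<Sum>v\<in>?V. m v) = (real n)\<^sup>2 - 2 * card ?E"
  proof -
    have "(\<Sum>v\<in>?V. m v) = n * real n - real (\<Sum>v\<in>?V. card {u\<in>?V. {v, u} \<in> ?E})"
      by (simp add: m_eq sum_subtractf n)
    then show ?thesis
      by (simp add: handshake[OF V E] power2_eq_square)
  qed
  have "(\<Sum>v\<in>?V. 1 / m v) \<le> k + 7"
  proof -
    \<comment> \<open>The penalty makes the weight of \<open>Q\<close> the left-hand side of
      \<open>card_clique_le\<close>. Over all vertices it costs \<open>n * (8 / n) = 8\<close>,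
      whence \<open>(k - 1) + 8 = k + 7\<close>.\<close>
    define w where "w v = 1 - 8 * m v / n" for v
    obtain Q where Q: "Q \<subseteq> ?V" "\<forall>u\<in>Q. \<forall>v\<in>Q. u \<noteq> v \<longrightarrow> {u, v} \<in> ?E"
      "(\<Sum>v\<in>?V. w v / m v) \<le> (\<Sum>v\<in>Q. w v)"
      using weighted_Caro_Wei[OF V, where adj = "\<lambda>u v. {u, v} \<in> ?E" and w = w] irr
      unfolding m_def by (auto simp: insert_commute)
    have "all_pairs Q \<subseteq> ?E"
      using Q(2) by (auto elim!: all_pairsE)
    from card_clique_le[OF G free k Q(1) this n rb]
    have "(\<Sum>v\<in>Q. w v) \<le> k - 1"
      by (simp add: w_def sum_subtractf m_def sum_distrib_left sum_divide_distrib)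
    moreover have "(\<Sum>v\<in>?V. w v / m v) = (\<Sum>v\<in>?V. 1 / m v - 8 / n)"
    proof (rule sum.cong)
      fix v assume "v \<in> ?V"
      then show "w v / m v = 1 / m v - 8 / n"
        using m_pos[of v] by (simp add: w_def diff_divide_distrib)
    qed simp
    moreover have "\<dots> = (\<Sum>v\<in>?V. 1 / m v) - 8"
      using n by (simp add: sum_subtractf)
    ultimately show ?thesis using Q(3) k by linarith
  qed
  note sum_le = this
  have ne: "?V \<noteq> {}" using n by auto
  have *: "s \<le> real k + 7" if "s > 0" "(real n)\<^sup>2 - 2 * card ?E \<le> (real n)\<^sup>2 / s" for s
  proof -
    have "(\<Sum>v\<in>?V. m v) \<le> (card ?V)\<^sup>2 / s"
      using that(2) by (simp add: sum_m n(1))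
    then have "s \<le> (\<Sum>v\<in>?V. 1 / m v)"
      using sum_inverse_ge[where m = m, OF V ne m_pos that(1)] by blast
    with sum_le show ?thesis by simp
  qed
  define d where "d = 1 - 2 * card ?E / (real n)\<^sup>2"
  have d: "(real n)\<^sup>2 - 2 * card ?E = (real n)\<^sup>2 * d"
    using n(2) by (simp add: d_def field_simps)
  have "(\<Sum>v\<in>?V. m v) > 0"
    using m_pos V ne by (intro sum_pos) auto
  then have "d > 0"
    unfolding sum_m d using n(2) by (simp add: zero_less_mult_iff)
  \<comment> \<open>This \<open>s\<close> turns the second hypothesis of \<open>*\<close> into an
    equality. Each vertex is its own non-neighbour, which is why \<open>d\<close> is
    positive.\<close>
  with *[of "1 / d"] have "1 / d \<le> real k + 7"
    unfolding d by simp
  with \<open>d > 0\<close> have "1 / (real k + 7) \<le> d"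
    by (simp add: field_simps)
  then show ?thesis by (simp add: d_def)
qed

section \<open>Blow-ups and homomorphisms\<close>

text \<open>A vertex \<open>i\<close> over \<open>V\<close> has \<open>q\<close> times the degree of
  \<open>\<phi> i\<close>, and there are \<open>q\<close> such vertices over each point of
  \<open>V\<close>; summing degrees gives the factor \<open>q^2\<close>. A pair inside a fibre has a
  singleton image and so is never an edge.\<close>

lemma card_blow_up:
  assumes U: "finite U" and V: "finite V" and X: "X \<subseteq> all_pairs V"
    and fibre: "\<And>v. v \<in> V \<Longrightarrow> card {i\<in>U. \<phi> i = v} = q"
  shows "card {e\<in>all_pairs U. \<phi> ` e \<in> X} = q\<^sup>2 * card X"
proof -
  let ?Y = "{e\<in>all_pairs U. \<phi> ` e \<in> X}"
  have pre: "{j\<in>U. {i, j} \<in> ?Y} = (\<Union>b\<in>{b\<in>V. {\<phi> i, b} \<in> X}. {j\<in>U. \<phi> j = b})" if "i \<in> U" for i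
  proof -
    have "\<phi> j \<in> V \<and> i \<noteq> j" if "{\<phi> i, \<phi> j} \<in> X" for j
      using edge_ends[OF that X] \<open>i \<in> U\<close> by auto
    then show ?thesis
      using \<open>i \<in> U\<close> by (auto simp: pair_in_all_pairs)
  qed
  have deg: "card {j\<in>U. {i, j} \<in> ?Y} = q * card {b\<in>V. {\<phi> i, b} \<in> X}" if "i \<in> U" for i
  proof -
    have "card {j\<in>U. {i, j} \<in> ?Y} = (\<Sum>b\<in>{b\<in>V. {\<phi> i, b} \<in> X}. card {j\<in>U. \<phi> j = b})"
      unfolding pre[OF that] using U V by (intro card_UN_disjoint) auto
    then show ?thesis by (simp add: fibre)
  qed
  have "2 * card ?Y = (\<Sum>i\<in>U. card {j\<in>U. {i, j} \<in> ?Y})"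
    by (rule handshake[symmetric, OF U]) auto
  also have "\<dots> = (\<Sum>i\<in>U. q * card {b\<in>V. {\<phi> i, b} \<in> X})"
    using deg by (intro sum.cong) auto
  \<comment> \<open>Vertices mapped outside \<open>V\<close> have degree 0.\<close>
  also have "\<dots> = (\<Sum>i\<in>{i\<in>U. \<phi> i \<in> V}. q * card {b\<in>V. {\<phi> i, b} \<in> X})"
  proof (rule sum.mono_neutral_right[OF U])
    show "\<forall>i\<in>U - {i\<in>U. \<phi> i \<in> V}. q * card {b\<in>V. {\<phi> i, b} \<in> X} = 0"
    proof
      fix i assume "i \<in> U - {i\<in>U. \<phi> i \<in> V}"
      then have "{b\<in>V. {\<phi> i, b} \<in> X} = {}"
        using edge_ends(1)[OF _ X] by auto
      then show "q * card {b\<in>V. {\<phi> i, b} \<in> X} = 0" by (simp del: Collect_empty_eq)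
    qed
  qed auto
  also have "\<dots> = (\<Sum>a\<in>V. \<Sum>i\<in>{i\<in>{i\<in>U. \<phi> i \<in> V}. \<phi> i = a}. q * card {b\<in>V. {\<phi> i, b} \<in> X})"
    by (rule sum.group[symmetric]) (use U V in auto)
  also have "\<dots> = (\<Sum>a\<in>V. q\<^sup>2 * card {b\<in>V. {a, b} \<in> X})"
  proof (rule sum.cong)
    fix a assume a: "a \<in> V"
    then have "{i\<in>{i\<in>U. \<phi> i \<in> V}. \<phi> i = a} = {i\<in>U. \<phi> i = a}" by auto
    moreover have "(\<Sum>i\<in>{i\<in>U. \<phi> i = a}. q * card {b\<in>V. {\<phi> i, b} \<in> X})
        = (\<Sum>i\<in>{i\<in>U. \<phi> i = a}. q * card {b\<in>V. {a, b} \<in> X})"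
      by (rule sum.cong) auto
    ultimately show "(\<Sum>i\<in>{i\<in>{i\<in>U. \<phi> i \<in> V}. \<phi> i = a}. q * card {b\<in>V. {\<phi> i, b} \<in> X})
        = q\<^sup>2 * card {b\<in>V. {a, b} \<in> X}"
      using fibre[OF a] by (simp add: power2_eq_square)
  qed simp
  also have "\<dots> = 2 * (q\<^sup>2 * card X)"
    by (simp add: sum_distrib_left[symmetric] handshake[OF V X])
  finally show ?thesis by simp
qed

text \<open>A color-preserving \<open>\<phi>\<close> may identify vertices, but never two adjacent
  ones, so it is injective on a copy of a complete graph. Hence a blow-up creates no new
  cliques.\<close>

lemma contains_hom:
  assumes c: "contains H F" and F: "edges F = all_pairs (verts F)" "2 \<le> card (verts F)"
    and G: "edges G \<subseteq> all_pairs (verts G)"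
    and r: "\<And>e. e \<in> red H \<Longrightarrow> \<phi> ` e \<in> red G" and b: "\<And>e. e \<in> blue H \<Longrightarrow> \<phi> ` e \<in> blue G"
  shows "contains G F"
proof -
  obtain f where f: "\<forall>e\<in>red F. f ` e \<in> red H" "\<forall>e\<in>blue F. f ` e \<in> blue H"
    using c by (auto simp: contains_def)
  have col: "\<forall>e\<in>red F. (\<phi> \<circ> f) ` e \<in> red G" "\<forall>e\<in>blue F. (\<phi> \<circ> f) ` e \<in> blue G"
    using f r b unfolding image_comp[symmetric] by blast+
  have pair: "\<phi> (f x) \<in> verts G \<and> \<phi> (f x) \<noteq> \<phi> (f y)" if "x \<in> verts F" "y \<in> verts F" "x \<noteq> y" for x y
  proof -
    have "{x, y} \<in> edges F"
      using that F by (simp add: pair_in_all_pairs)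
    then have "(\<phi> \<circ> f) ` {x, y} \<in> edges G"
      using col unfolding edges_def by blast
    then have "{\<phi> (f x), \<phi> (f y)} \<in> all_pairs (verts G)"
      using G by auto
    then show ?thesis by (simp add: pair_in_all_pairs)
  qed
  have "inj_on (\<phi> \<circ> f) (verts F)"
    using pair by (auto simp: inj_on_def)
  moreover have "(\<phi> \<circ> f) ` verts F \<subseteq> verts G"
  proof
    fix z assume "z \<in> (\<phi> \<circ> f) ` verts F"
    then obtain x where x: "x \<in> verts F" "z = \<phi> (f x)" by auto
    \<comment> \<open>\<open>\<phi>\<close> is controlled only along edges, so a second vertex is
      used to put \<open>x\<close> on an edge.\<close>
    have "verts F \<noteq> {x}" using F(2) by auto
    then obtain y where "y \<in> verts F" "y \<noteq> x" using x by blast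
    then show "z \<in> verts G" using pair x by metis
  qed
  ultimately show ?thesis
    using col unfolding contains_def by blast
qed

section \<open>Extremal numbers and their lower bounds\<close>

definition ex_graphs :: "real \<Rightarrow> nat \<Rightarrow> nat bicolored_graph set \<Rightarrow> nat bicolored_graph set" where
  "ex_graphs \<epsilon> n \<F> = {G. is_bicolored_graph G \<and> card (verts G) = n \<and> balanced \<epsilon> G \<and>
     (\<forall>F\<in>\<F>. \<not> contains G F)}"

lemma ex_number_eq: "ex_number \<epsilon> n \<F> = Max ((\<lambda>G. card (edges G)) ` ex_graphs \<epsilon> n \<F>)"
  unfolding ex_number_def ex_graphs_def by (simp add: setcompr_eq_image)

text \<open>Vertices are arbitrary naturals, so there are in general infinitely many such graphs;
  their sizes are bounded because edges are subsets of an \<open>n\<close>-set.\<close>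

lemma finite_ex_graph_sizes: "finite ((\<lambda>G. card (edges G)) ` ex_graphs \<epsilon> n \<F>)"
proof (rule finite_subset)
  show "(\<lambda>G. card (edges G)) ` ex_graphs \<epsilon> n \<F> \<subseteq> {..2 ^ n}"
  proof (rule image_subsetI)
    fix G assume "G \<in> ex_graphs \<epsilon> n \<F>"
    then have G: "finite (verts G)" "edges G \<subseteq> Pow (verts G)" "card (verts G) = n"
      by (auto simp: ex_graphs_def is_bicolored_graph_def all_pairs_def)
    then show "card (edges G) \<in> {..2 ^ n}"
      using card_mono[of "Pow (verts G)" "edges G"] by (auto simp: card_Pow)
  qed
qed simp

lemma ex_number_ge: "G \<in> ex_graphs \<epsilon> n \<F> \<Longrightarrow> card (edges G) \<le> ex_number \<epsilon> n \<F>"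
  unfolding ex_number_eq by (rule Max_ge[OF finite_ex_graph_sizes]) simp

text \<open>The edgeless graph is balanced and contains nothing that has an edge, so
  \<open>Max\<close> is taken over a nonempty set.\<close>

lemma ex_number_attained:
  assumes "\<And>F. F \<in> \<F> \<Longrightarrow> edges F \<noteq> {}"
  obtains G where "G \<in> ex_graphs \<epsilon> n \<F>" "card (edges G) = ex_number \<epsilon> n \<F>"
proof -
  have "\<lparr>verts = {..<n}, red = {}, blue = {}\<rparr> \<in> ex_graphs \<epsilon> n \<F>"
    using assms
    by (fastforce simp: ex_graphs_def is_bicolored_graph_def edges_def balanced_def contains_def)
  then have "ex_number \<epsilon> n \<F> \<in> (\<lambda>G. card (edges G)) ` ex_graphs \<epsilon> n \<F>"
    unfolding ex_number_eq by (intro Max_in[OF finite_ex_graph_sizes]) auto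
  then show ?thesis using that by auto
qed

lemma nonmono_cliques_edges_ne: "F \<in> nonmono_cliques k \<Longrightarrow> edges F \<noteq> {}"
  by (auto simp: nonmono_cliques_def non_monochromatic_def edges_def)

text \<open>Replace each vertex of an extremal graph by \<open>m div n\<close> copies and leave the
  remaining \<open>m mod n\<close> vertices isolated. Both color classes scale by the same factor,
  which preserves balance.\<close>

lemma ex_number_blow_up:
  assumes k: "2 \<le> k" and n: "0 < n"
  shows "(m div n)\<^sup>2 * ex_number \<epsilon> n (nonmono_cliques k) \<le> ex_number \<epsilon> m (nonmono_cliques k)"
proof -
  let ?F = "nonmono_cliques k"
  obtain G where G: "G \<in> ex_graphs \<epsilon> n ?F" "card (edges G) = ex_number \<epsilon> n ?F"
    by (rule ex_number_attained[OF nonmono_cliques_edges_ne])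
  have bi: "finite (verts G)" "edges G \<subseteq> all_pairs (verts G)" "red G \<inter> blue G = {}"
    and cG: "card (verts G) = n" and bal: "balanced \<epsilon> G" and free: "\<forall>F\<in>?F. \<not> contains G F"
    using G by (auto simp: ex_graphs_def is_bicolored_graph_def)
  define q where "q = m div n"
  obtain h where h: "bij_betw h {..<n} (verts G)"
    using ex_bij_betw_nat_finite[OF bi(1)] cG by (metis atLeast0LessThan)
  \<comment> \<open>Residues modulo \<open>n\<close> split the first \<open>n * q\<close> naturals
    into \<open>n\<close> fibres of size exactly \<open>q\<close>.\<close>
  define \<phi> where "\<phi> i = h (i mod n)" for i
  define U where "U = {..<n * q}"
  define bl where "bl X = {e\<in>all_pairs U. \<phi> ` e \<in> X}" for X
  have fibre: "card {i\<in>U. \<phi> i = v} = q" if v: "v \<in> verts G" for v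
  proof -
    obtain a where a: "a < n" "h a = v"
      using h v unfolding bij_betw_def by (metis imageE lessThan_iff)
    have "{i\<in>U. \<phi> i = v} = (\<lambda>j. j * n + a) ` {..<q}"
    proof (intro equalityI subsetI)
      fix i assume "i \<in> {i\<in>U. \<phi> i = v}"
      then have i: "i < n * q" "h (i mod n) = h a"
        using a by (auto simp: U_def \<phi>_def)
      then have "i mod n = a"
        using h a n by (auto simp: bij_betw_def inj_on_def)
      then have "i = (i div n) * n + a"
        by (metis div_mult_mod_eq)
      moreover have "i div n < q"
        using i(1) by (simp add: less_mult_imp_div_less mult.commute)
      ultimately show "i \<in> (\<lambda>j. j * n + a) ` {..<q}" by blast
    next
      fix i assume "i \<in> (\<lambda>j. j * n + a) ` {..<q}"
      then obtain j where j: "j < q" "i = j * n + a" by auto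
      have "j * n + a < Suc j * n" using a by simp
      also have "\<dots> \<le> q * n" using j by (intro mult_right_mono) auto
      finally show "i \<in> {i\<in>U. \<phi> i = v}"
        using j a by (auto simp: U_def \<phi>_def mult.commute)
    qed
    moreover have "inj_on (\<lambda>j. j * n + a) {..<q}"
      using n by (auto simp: inj_on_def)
    ultimately show ?thesis by (simp add: card_image)
  qed
  have card_bl: "card (bl X) = q\<^sup>2 * card X" if "X \<subseteq> edges G" for X
    unfolding bl_def using fibre that bi by (intro card_blow_up) (auto simp: U_def)
  define H where "H = \<lparr>verts = {..<m}, red = bl (red G), blue = bl (blue G)\<rparr>"
  have edges_H: "edges H = bl (edges G)"
    by (auto simp: H_def edges_def bl_def)
  have "H \<in> ex_graphs \<epsilon> m ?F"
    unfolding ex_graphs_def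
  proof (intro CollectI conjI ballI notI)
    have "n * q \<le> m" by (simp add: q_def)
    then have "bl X \<subseteq> all_pairs {..<m}" for X
      by (fastforce simp: bl_def all_pairs_def U_def)
    moreover have "bl (red G) \<inter> bl (blue G) = {}"
      using bi(3) by (auto simp: bl_def)
    ultimately show "is_bicolored_graph H"
      unfolding is_bicolored_graph_def edges_H by (auto simp: H_def)
    show "card (verts H) = m" by (simp add: H_def)
    show "balanced \<epsilon> H"
    proof -
      have "red G \<subseteq> edges G" "blue G \<subseteq> edges G" by (auto simp: edges_def)
      then have c: "card (red H) = q\<^sup>2 * card (red G)" "card (blue H) = q\<^sup>2 * card (blue G)"
        "card (edges H) = q\<^sup>2 * card (edges G)"
        by (auto simp: edges_H card_bl) (auto simp: H_def card_bl)
      have "q\<^sup>2 * (\<epsilon> * card (edges G)) \<le> q\<^sup>2 * card (red G)"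
        "q\<^sup>2 * (\<epsilon> * card (edges G)) \<le> q\<^sup>2 * card (blue G)"
        using bal unfolding balanced_def by (auto intro!: mult_left_mono)
      then show ?thesis
        unfolding balanced_def c by (simp add: mult.left_commute)
    qed
    fix F assume F: "F \<in> ?F" "contains H F"
    have "contains G F"
    proof (rule contains_hom[where \<phi> = \<phi>, OF F(2) _ _ bi(2)])
      show "edges F = all_pairs (verts F)" "2 \<le> card (verts F)"
        using F(1) k by (simp_all add: nonmono_cliques_def)
    qed (simp_all add: H_def bl_def)
    then show False using free F by blast
  qed
  from ex_number_ge[OF this] show ?thesis
    unfolding edges_H using G(2) by (simp add: card_bl q_def)
qed

text \<open>The parts are \<open>{2 v, 2 v + 1}\<close>. Size 2 makes the number of edges even, so
  an arbitrary half can be colored red.\<close>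

lemma ex_number_Turan_ge:
  assumes k: "3 \<le> k"
  shows "4 * ((k - 1) choose 2) \<le> ex_number (1 / 2) (2 * (k - 1)) (nonmono_cliques k)"
proof -
  define U where "U = {..<2 * (k - 1)}"
  define \<phi> where "\<phi> i = i div 2" for i :: nat
  define E where "E = {e\<in>all_pairs U. \<phi> ` e \<in> all_pairs {..<k - 1}}"
  have "card {i\<in>U. \<phi> i = v} = 2" if "v \<in> {..<k - 1}" for v
  proof -
    have "{i\<in>U. \<phi> i = v} = {2 * v, 2 * v + 1}"
      using that by (auto simp: U_def \<phi>_def)
    then show ?thesis by simp
  qed
  then have "card E = 2\<^sup>2 * card (all_pairs {..<k - 1})"
    unfolding E_def by (intro card_blow_up[where V = "{..<k - 1}"]) (auto simp: U_def)
  then have cE: "card E = 4 * ((k - 1) choose 2)"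
    by (simp add: all_pairs_def n_subsets)
  have fE: "finite E"
    unfolding E_def using finite_all_pairs[of U] by (simp add: U_def)
  obtain R where R: "R \<subseteq> E" "card R = 2 * ((k - 1) choose 2)"
    using obtain_subset_with_card_n[of "2 * ((k - 1) choose 2)" E] cE by auto
  define H where "H = \<lparr>verts = U, red = R, blue = E - R\<rparr>"
  have eH: "edges H = E" using R by (auto simp: H_def edges_def)
  have cB: "card (E - R) = 2 * ((k - 1) choose 2)"
    using R cE fE finite_subset[OF R(1) fE] by (simp add: card_Diff_subset)
  have "H \<in> ex_graphs (1 / 2) (2 * (k - 1)) (nonmono_cliques k)"
    unfolding ex_graphs_def
  proof (intro CollectI conjI ballI notI)
    show "is_bicolored_graph H"
      unfolding is_bicolored_graph_def eH by (auto simp: H_def U_def E_def)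
    show "card (verts H) = 2 * (k - 1)" by (simp add: H_def U_def)
    show "balanced (1 / 2) H"
      unfolding balanced_def eH cE by (simp add: H_def R cB)
    fix F assume F: "F \<in> nonmono_cliques k" "contains H F"
    then have F': "card (verts F) = k" "edges F = all_pairs (verts F)"
      by (auto simp: nonmono_cliques_def)
    \<comment> \<open>Every pair gets both colors, so any map sending edges to pairs respects
      colors, and \<open>contains_hom\<close> yields an injection of \<open>k\<close> vertices into
      \<open>k - 1\<close>.\<close>
    define K where "K = \<lparr>verts = {..<k - 1}, red = all_pairs {..<k - 1}, blue = all_pairs {..<k - 1}\<rparr>"
    have "contains K F"
      by (rule contains_hom[OF F(2), where \<phi> = \<phi>])
        (use F' R k in \<open>auto simp: K_def H_def E_def edges_def\<close>)
    then obtain f where "inj_on f (verts F)" "f ` verts F \<subseteq> {..<k - 1}"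
      by (auto simp: contains_def K_def)
    then have "card (verts F) \<le> card {..<k - 1}"
      by (intro card_inj_on_le) auto
    then show False using F' k by simp
  qed
  from ex_number_ge[OF this] show ?thesis by (simp add: eH cE)
qed

section \<open>Convergence of the edge densities\<close>

text \<open>The limit is the supremum of \<open>2 f n / n^2\<close>: blowing up a nearly optimal
  \<open>n\<close> gives the lower estimate for all large \<open>m\<close>, and
  \<open>m^2 / (m (m - 1))\<close> tends to 1 for the upper one.\<close>

lemma blow_up_limit:
  fixes f :: "nat \<Rightarrow> nat" and U :: real
  assumes blow: "\<And>m n. 0 < n \<Longrightarrow> (m div n)\<^sup>2 * f n \<le> f m"
    and U: "\<And>n. 0 < n \<Longrightarrow> 2 * f n / (real n)\<^sup>2 \<le> U"
  obtains L where "(\<lambda>n. f n / (n choose 2)) \<longlonglongrightarrow> L" "L \<le> U"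
    "\<And>n. 0 < n \<Longrightarrow> 2 * f n / (real n)\<^sup>2 \<le> L"
proof -
  define a where "a n = 2 * f n / (real n)\<^sup>2" for n
  define L where "L = (SUP n\<in>{0<..}. a n)"
  have bdd: "bdd_above (a ` {0<..})"
    using U by (auto simp: a_def intro!: bdd_aboveI)
  have aL: "a n \<le> L" if "0 < n" for n
    unfolding L_def using that by (intro cSUP_upper[OF _ bdd]) auto
  have LU: "L \<le> U"
    unfolding L_def using U by (intro cSUP_least) (auto simp: a_def)
  have binom: "real (m choose 2) = real m * (real m - 1) / 2" for m
    by (simp add: binomial_gbinomial gbinomial_prod_rev numeral_2_eq_2)
  have "(\<lambda>n. f n / (n choose 2)) \<longlonglongrightarrow> L"
  proof (rule order_tendstoI)
    fix y assume "y < L"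
    then obtain n where n: "0 < n" "y < a n"
      unfolding L_def using less_cSUP_iff[OF _ bdd] by auto
    \<comment> \<open>The factor comes from \<open>m div n \<ge> m / n - 1\<close>, divided by
      \<open>m\<close> and squared.\<close>
    have "(\<lambda>m. (1 / n - 1 / real m)\<^sup>2 * (2 * f n)) \<longlonglongrightarrow> (1 / n - 0)\<^sup>2 * (2 * f n)"
      by (intro tendsto_intros lim_1_over_n)
    moreover have "(1 / n - 0)\<^sup>2 * (2 * f n) = a n"
      by (simp add: a_def power_divide)
    ultimately have "\<forall>\<^sub>F m in sequentially. y < (1 / n - 1 / real m)\<^sup>2 * (2 * f n)"
      using n(2) order_tendstoD(1) by metis
    moreover have "\<forall>\<^sub>F m in sequentially. max 2 n \<le> m"
      by (rule eventually_ge_at_top)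
    ultimately show "\<forall>\<^sub>F m in sequentially. y < f m / (m choose 2)"
    proof eventually_elim
      case (elim m)
      then have m: "2 \<le> m" "n \<le> m" by auto
      have "real m / n - 1 \<le> real (m div n)"
        using floor_divide_of_nat_eq[of m n, where ?'a = real] by linarith
      moreover have "0 \<le> real m / n - 1"
        using m n by simp
      ultimately have "(real m / n - 1)\<^sup>2 * f n \<le> (real (m div n))\<^sup>2 * f n"
        by (intro mult_right_mono power_mono) auto
      also have "\<dots> \<le> f m"
        using blow[OF n(1), of m] by (metis of_nat_le_iff of_nat_mult of_nat_power)
      finally have "(real m / n - 1)\<^sup>2 * f n \<le> f m" .
      then have "(real m / n - 1)\<^sup>2 * f n / ((real m)\<^sup>2 / 2) \<le> f m / ((real m)\<^sup>2 / 2)"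
        by (intro divide_right_mono) auto
      also have "\<dots> \<le> f m / (m choose 2)"
        using m unfolding binom
        by (intro divide_left_mono) (auto simp: power2_eq_square)
      also have "(real m / n - 1)\<^sup>2 * f n / ((real m)\<^sup>2 / 2) = (1 / n - 1 / real m)\<^sup>2 * (2 * f n)"
        using m n by (simp add: power2_eq_square field_simps)
      finally show ?case using elim by linarith
    qed
  next
    fix y assume "L < y"
    have "(\<lambda>m. L * inverse (1 - 1 / real m)) \<longlonglongrightarrow> L * inverse (1 - 0)"
      by (intro tendsto_intros lim_1_over_n) simp
    then have "\<forall>\<^sub>F m in sequentially. L * inverse (1 - 1 / real m) < y"
      using \<open>L < y\<close> order_tendstoD(2) by fastforce
    moreover have "\<forall>\<^sub>F m in sequentially. 2 \<le> m"
      by (rule eventually_ge_at_top)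
    ultimately show "\<forall>\<^sub>F m in sequentially. f m / (m choose 2) < y"
    proof eventually_elim
      case (elim m)
      have "f m / (m choose 2) = a m * inverse (1 - 1 / real m)"
        using elim unfolding binom a_def by (simp add: power2_eq_square field_simps)
      also have "\<dots> \<le> L * inverse (1 - 1 / real m)"
        using elim by (intro mult_right_mono aL) (auto simp: field_simps)
      finally show ?case using elim by linarith
    qed
  qed
  then show ?thesis
    using that LU aL unfolding a_def by blast
qed

section \<open>Comparison of the two bounds on the limit\<close>

theorem theorem1p6:
  "\<exists>C :: real. \<forall>k :: nat. k \<ge> 3 \<longrightarrow>
     convergent (ex_ratio (1 / 2) (nonmono_cliques k)) \<and>
     (\<exists>c :: real. \<bar>c\<bar> \<le> C \<and> real k + c \<noteq> 0 \<and>
        ex_density (1 / 2) (nonmono_cliques k) = 1 - 1 / (real k + c))"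
proof (intro exI[of _ 7] allI impI)
  fix k :: nat assume k: "k \<ge> 3"
  define f where "f n = ex_number (1 / 2) n (nonmono_cliques k)" for n
  have U: "2 * f n / (real n)\<^sup>2 \<le> 1 - 1 / (real k + 7)" if "0 < n" for n
  proof -
    obtain G where "G \<in> ex_graphs (1 / 2) n (nonmono_cliques k)" "card (edges G) = f n"
      unfolding f_def by (rule ex_number_attained[OF nonmono_cliques_edges_ne])
    then show ?thesis
      using edge_density_le[of G k n] k that by (auto simp: ex_graphs_def)
  qed
  have "(m div n)\<^sup>2 * f n \<le> f m" if "0 < n" for m n
    unfolding f_def using k that by (intro ex_number_blow_up) auto
  from blow_up_limit[of f, OF this U] obtain L where L:
    "(\<lambda>n. f n / (n choose 2)) \<longlonglongrightarrow> L" "L \<le> 1 - 1 / (real k + 7)"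
    "\<And>n. 0 < n \<Longrightarrow> 2 * f n / (real n)\<^sup>2 \<le> L"
    by blast
  \<comment> \<open>With \<open>j = k - 1\<close>, the Turan graph on \<open>2 j\<close> vertices
    has \<open>2 j (j - 1)\<close> edges, and
    \<open>2 * 2 j (j - 1) / (2 j)^2 = 1 - 1 / j\<close>.\<close>
  have "1 - 1 / (real k - 1) \<le> L"
  proof -
    define j where "j = k - 1"
    have j: "real j = real k - 1" "2 \<le> j" using k by (auto simp: j_def)
    have "real (4 * (j choose 2)) \<le> f (2 * j)"
      unfolding f_def j_def using ex_number_Turan_ge[OF k] by (simp only: of_nat_le_iff)
    moreover have "real (j choose 2) = real j * (real j - 1) / 2"
      by (simp add: binomial_gbinomial gbinomial_prod_rev numeral_2_eq_2)
    ultimately have "2 * real j * (real j - 1) \<le> f (2 * j)" by simp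
    then have "2 * (2 * real j * (real j - 1)) / (real (2 * j))\<^sup>2 \<le> 2 * f (2 * j) / (real (2 * j))\<^sup>2"
      by (intro divide_right_mono) auto
    also have "\<dots> \<le> L" using L(3)[of "2 * j"] j by simp
    also have "2 * (2 * real j * (real j - 1)) / (real (2 * j))\<^sup>2 = 1 - 1 / real j"
      using j by (simp add: power2_eq_square field_simps)
    finally show ?thesis by (simp add: j)
  qed
  moreover have d: "1 - L > 0"
    using L(2) by (smt (verit) divide_pos_pos of_nat_0_le_iff)
  ultimately have "real k - 1 \<le> 1 / (1 - L)" "1 / (1 - L) \<le> real k + 7"
    using L(2) k by (auto simp: field_simps)
  \<comment> \<open>Solves \<open>L = 1 - 1 / (k + c)\<close>; the two bounds place \<open>c\<close>
    between -1 and 7.\<close>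
  moreover define c where "c = 1 / (1 - L) - k"
  ultimately have "\<bar>c\<bar> \<le> 7"
    by linarith
  moreover have "real k + c \<noteq> 0" "L = 1 - 1 / (real k + c)"
    using d by (simp_all add: c_def)
  moreover have ratio: "ex_ratio (1 / 2) (nonmono_cliques k) \<longlonglongrightarrow> L"
    using L(1) by (simp add: ex_ratio_def[abs_def] f_def)
  ultimately show "convergent (ex_ratio (1 / 2) (nonmono_cliques k)) \<and>
     (\<exists>c :: real. \<bar>c\<bar> \<le> 7 \<and> real k + c \<noteq> 0 \<and>
        ex_density (1 / 2) (nonmono_cliques k) = 1 - 1 / (real k + c))"
    unfolding ex_density_def limI[OF ratio] using convergentI[OF ratio] by blast
qed

end
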